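(* Let $A$ be an $n$-by-$n$ reciprocal matrix that is not consistent, and let $\mathcal{C}$ be a Hamiltonian cycle with cycle product in $A$ at most $1$. Then there is a $w\in\varepsilon_A(\mathcal{C})$ that exhibits no order reversal at any pair $i,j$ with $i\to j$ an edge of $\mathcal{C}$ if and only if either some entry of $A$ along $\mathcal{C}$ is $>1$ or the cycle product of $\mathcal{C}$ in $A$ equals $1$. Otherwise, there is a $w\in\varepsilon_A(\mathcal{C})$ exhibiting an order reversal at exactly one pair $i,j$ with $i\to j$ an edge of $\mathcal{C}$.
   Context: An $n$-by-$n$ matrix $A=[a_{ij}]$ is reciprocal if all its entries are positive and $a_{ji}=1/a_{ij}$; it is consistent if $A=[w_i/w_j]$ for some positive $w$. For a Hamiltonian cycle $\mathcal{C}:\gamma_1\to\cdots\to\gamma_n\to\gamma_1$, the entries of $A$ along $\mathcal{C}$ are $a_{\gamma_1\gamma_2},\dots,a_{\gamma_{n-1}\gamma_n},a_{\gamma_n\gamma_1}$ and its cycle product is their product. $G(A,w)$ is the digraph on $\{1,\dots,n\}$ with an edge $i\to j$ ($i\ne j$) iff $w_i\ge a_{ij}w_j$; $\varepsilon_A(\mathcal{C})$ is the set of positive $w$ such that $G(A,w)$ contains $\mathcal{C}$. A positive vector $w$ exhibits an order reversal at $i,j$ if $w_i>w_j$ when $a_{ij}<1$, or $w_i<w_j$ when $a_{ij}>1$, or $w_i=w_j$ when $a_{ij}\ne 1$, or $w_i\ne w_j$ when $a_{ij}=1$. *)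

theory Defs
  imports "HOL-Analysis.Analysis" "Graph_Theory.Pair_Digraph"
begin

text \<open>
  The index set \<open>{1, \<dots>, n}\<close> is rendered by a finite type \<open>'n\<close>, with \<open>n = CARD('n)\<close>.
\<close>

definition positive_vec :: "real ^ 'n \<Rightarrow> bool" where
  "positive_vec w \<longleftrightarrow> (\<forall>i. 0 < w $ i)"

definition reciprocal_matrix :: "real ^ 'n ^ 'n \<Rightarrow> bool" where
  "reciprocal_matrix A \<longleftrightarrow>
     (\<forall>i j. 0 < A $ i $ j) \<and> (\<forall>i j. A $ j $ i = 1 / A $ i $ j)"

definition consistent_matrix :: "real ^ 'n ^ 'n \<Rightarrow> bool" where
  "consistent_matrix A \<longleftrightarrow> (\<exists>w. positive_vec w \<and> A = (\<chi> i j. w $ i / w $ j))"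

text \<open>
  A Hamiltonian cycle \<open>\<gamma>\<^sub>1 \<rightarrow> \<cdots> \<rightarrow> \<gamma>\<^sub>n \<rightarrow> \<gamma>\<^sub>1\<close> is given by the list \<open>[\<gamma>\<^sub>1, \<dots>, \<gamma>\<^sub>n]\<close> of its
  vertices; the closing edge \<open>\<gamma>\<^sub>n \<rightarrow> \<gamma>\<^sub>1\<close> is the last element of the edge list. Lists of length
  1 and 2 are not excluded, but all reciprocal matrices of these sizes are consistent.
\<close>

definition hamiltonian_cycle :: "'n list \<Rightarrow> bool" where
  "hamiltonian_cycle \<gamma> \<longleftrightarrow> distinct \<gamma> \<and> set \<gamma> = UNIV"

definition cycle_edges :: "'n list \<Rightarrow> ('n \<times> 'n) list" where
  "cycle_edges \<gamma> = zip \<gamma> (rotate1 \<gamma>)"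

definition entries_along :: "real ^ 'n ^ 'n \<Rightarrow> 'n list \<Rightarrow> real list" where
  "entries_along A \<gamma> = map (\<lambda>(i, j). A $ i $ j) (cycle_edges \<gamma>)"

definition cycle_product :: "real ^ 'n ^ 'n \<Rightarrow> 'n list \<Rightarrow> real" where
  "cycle_product A \<gamma> = prod_list (entries_along A \<gamma>)"

definition comparison_digraph :: "real ^ 'n ^ 'n \<Rightarrow> real ^ 'n \<Rightarrow> 'n pair_pre_digraph" where
  "comparison_digraph A w =
     \<lparr> pverts = UNIV, parcs = {(i, j). i \<noteq> j \<and> w $ i \<ge> A $ i $ j * w $ j} \<rparr>"

definition cycle_vectors :: "real ^ 'n ^ 'n \<Rightarrow> 'n list \<Rightarrow> (real ^ 'n) set" where
  "cycle_vectors A \<gamma> =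
     {w. positive_vec w \<and> set (cycle_edges \<gamma>) \<subseteq> parcs (comparison_digraph A w)}"

definition order_reversal :: "real ^ 'n ^ 'n \<Rightarrow> real ^ 'n \<Rightarrow> 'n \<Rightarrow> 'n \<Rightarrow> bool" where
  "order_reversal A w i j \<longleftrightarrow>
     (A $ i $ j < 1 \<and> w $ i > w $ j) \<or>
     (A $ i $ j > 1 \<and> w $ i < w $ j) \<or>
     (A $ i $ j \<noteq> 1 \<and> w $ i = w $ j) \<or>
     (A $ i $ j = 1 \<and> w $ i \<noteq> w $ j)"

end

theory Submission
  imports Defs
begin

text \<open>
  A vector \<open>w\<close> lies in \<open>\<epsilon>\<^sub>A(C)\<close> iff its ratios \<open>w\<^sub>i / w\<^sub>j\<close> along the edges dominate the entries \<open>a\<^sub>i\<^sub>j\<close>,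
  and positive numbers attached to the edges are the ratios of some \<open>w\<close> iff their product is 1.
  Since the cycle product is \<open>P \<le> 1\<close>, we may take as ratios the entries themselves, except that a single
  entry \<open>a\<close> is replaced by \<open>a / P\<close>: only that edge can then carry an order reversal, and it carries none
  if \<open>a > 1\<close> or \<open>P = 1\<close>. Conversely, if all entries are at most 1 and one is less than 1, then
  without order reversals \<open>w\<close> would be weakly increasing around the cycle and once strictly.
\<close>

lemma length_cycle_edges [simp]: "length (cycle_edges \<gamma>) = length \<gamma>"
  by (simp add: cycle_edges_def)

lemma length_entries_along [simp]: "length (entries_along A \<gamma>) = length \<gamma>"
  by (simp add: entries_along_def)

lemma nth_cycle_edges:
  "m < length \<gamma> \<Longrightarrow> cycle_edges \<gamma> ! m = (\<gamma> ! m, \<gamma> ! (Suc m mod length \<gamma>))"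
  by (simp add: cycle_edges_def nth_rotate1)

lemma nth_entries_along:
  "m < length \<gamma> \<Longrightarrow> entries_along A \<gamma> ! m = A $ (\<gamma> ! m) $ (\<gamma> ! (Suc m mod length \<gamma>))"
  by (simp add: entries_along_def nth_cycle_edges)

lemma set_cycle_edges:
  "set (cycle_edges \<gamma>) = (\<lambda>m. (\<gamma> ! m, \<gamma> ! (Suc m mod length \<gamma>))) ` {..<length \<gamma>}"
proof -
  have "set (cycle_edges \<gamma>) = (!) (cycle_edges \<gamma>) ` {..<length \<gamma>}"
    by (metis length_cycle_edges lessThan_atLeast0 list.set_map map_nth set_upt)
  then show ?thesis
    by (simp add: nth_cycle_edges cong: image_cong_simp)
qed

lemma set_entries_along:
  "set (entries_along A \<gamma>) = (\<lambda>(i, j). A $ i $ j) ` set (cycle_edges \<gamma>)"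
  by (simp add: entries_along_def)

text \<open>The tails of the edges, in order, form \<open>\<gamma>\<close> and the heads form its
  rotation, and rotating a list does not change a sum over it.\<close>

lemma sum_list_cycle_edges_fst: "(\<Sum>e\<leftarrow>cycle_edges \<gamma>. f (fst e)) = (\<Sum>i\<leftarrow>\<gamma>. f i)"
  and sum_list_cycle_edges_snd:
    "(\<Sum>e\<leftarrow>cycle_edges \<gamma>. f (snd e)) = (\<Sum>i\<leftarrow>\<gamma>. f i)" for f :: "'n \<Rightarrow> real"
proof -
  have "map (\<lambda>e. f (fst e)) (cycle_edges \<gamma>) = map f \<gamma>"
    and snd: "map (\<lambda>e. f (snd e)) (cycle_edges \<gamma>) = map f (rotate1 \<gamma>)"
    by (auto simp: cycle_edges_def intro!: nth_equalityI)
  then show "(\<Sum>e\<leftarrow>cycle_edges \<gamma>. f (fst e)) = (\<Sum>i\<leftarrow>\<gamma>. f i)"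
    by simp
  have "(\<Sum>i\<leftarrow>rotate1 \<gamma>. f i) = (\<Sum>i\<leftarrow>\<gamma>. f i)"
    by (cases \<gamma>) simp_all
  with snd show "(\<Sum>e\<leftarrow>cycle_edges \<gamma>. f (snd e)) = (\<Sum>i\<leftarrow>\<gamma>. f i)"
    by simp
qed

text \<open>The values of \<open>f\<close> at the tails and at the heads have the same sum, so
  increases along all edges, one of them strict, are impossible.\<close>

lemma no_strict_increase_around_cycle:
  fixes f :: "'n \<Rightarrow> real"
  assumes le: "\<And>i j. (i, j) \<in> set (cycle_edges \<gamma>) \<Longrightarrow> f i \<le> f j"
    and edge: "(i, j) \<in> set (cycle_edges \<gamma>)"
  shows "f i = f j"
proof (rule ccontr)
  assume "f i \<noteq> f j"
  then have "f i < f j"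
    using le[OF edge] by simp
  have "(\<Sum>e\<leftarrow>cycle_edges \<gamma>. f (fst e)) < (\<Sum>e\<leftarrow>cycle_edges \<gamma>. f (snd e))"
    unfolding sum_list_sum_nth length_map
  proof (rule sum_strict_mono_ex1)
    show "\<forall>m\<in>{0..<length (cycle_edges \<gamma>)}.
        map (\<lambda>e. f (fst e)) (cycle_edges \<gamma>) ! m \<le> map (\<lambda>e. f (snd e)) (cycle_edges \<gamma>) ! m"
      using le by (simp add: set_cycle_edges nth_cycle_edges)
    obtain m where "m < length (cycle_edges \<gamma>)" "cycle_edges \<gamma> ! m = (i, j)"
      using edge by (auto simp: in_set_conv_nth)
    with \<open>f i < f j\<close> show "\<exists>m\<in>{0..<length (cycle_edges \<gamma>)}.
        map (\<lambda>e. f (fst e)) (cycle_edges \<gamma>) ! m < map (\<lambda>e. f (snd e)) (cycle_edges \<gamma>) ! m"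
      by (intro bexI[of _ m]) simp_all
  qed simp
  then show False
    by (simp add: sum_list_cycle_edges_fst sum_list_cycle_edges_snd)
qed

text \<open>Each vertex receives the product of the ratios from its own position to the end of the
  list. Neighbouring products differ by exactly one factor, and the total product 1 makes the
  closing edge fit.\<close>

lemma exists_vec_with_ratios:
  fixes \<gamma> :: "'n::finite list" and r :: "nat \<Rightarrow> real"
  assumes ham: "hamiltonian_cycle \<gamma>"
    and pos: "\<And>m. m < length \<gamma> \<Longrightarrow> 0 < r m"
    and prod: "(\<Prod>m<length \<gamma>. r m) = 1"
  obtains w where "positive_vec w"
    and "\<And>m. m < length \<gamma> \<Longrightarrow> w $ (\<gamma> ! m) = r m * w $ (\<gamma> ! (Suc m mod length \<gamma>))"
proof -
  define n where "n = length \<gamma>"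
  have bij: "bij_betw ((!) \<gamma>) {..<n} UNIV"
    using ham bij_betw_nth[of \<gamma> "{..<n}" UNIV] by (simp add: hamiltonian_cycle_def n_def)
  define idx where "idx = the_inv_into {..<n} ((!) \<gamma>)"
  have idx: "idx (\<gamma> ! m) = m" if "m < n" for m
    using bij that by (simp add: idx_def bij_betw_def the_inv_into_f_f)
  define w where "w = (\<chi> i. \<Prod>l\<in>{idx i..<n}. r l)"
  have w: "w $ (\<gamma> ! m) = (\<Prod>l\<in>{m..<n}. r l)" if "m < n" for m
    using that by (simp add: w_def idx)
  have "positive_vec w"
    using pos by (auto simp: positive_vec_def w_def n_def intro!: prod_pos)
  moreover have "w $ (\<gamma> ! m) = r m * w $ (\<gamma> ! (Suc m mod n))" if "m < n" for m
  proof (cases "Suc m = n")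
    case True
    \<comment> \<open>On the closing edge the last vertex carries the single factor
      \<open>r m\<close>, and its successor, the first vertex, carries the whole product.\<close>
    have "w $ (\<gamma> ! 0) = 1"
      using prod that by (subst w) (auto simp: n_def atLeast0LessThan)
    with True that show ?thesis
      by (auto simp: w)
  next
    case False
    with that show ?thesis
      by (simp add: w prod.atLeast_Suc_lessThan)
  qed
  ultimately show ?thesis
    using that by (simp add: n_def)
qed

lemma cycle_product_eq_prod:
  "cycle_product A \<gamma> = (\<Prod>m<length \<gamma>. entries_along A \<gamma> ! m)"
proof -
  \<comment> \<open>List recursion removes the first factor, so the indexed product is split at
    index 0, not at its last index.\<close>
  have "prod_list xs = (\<Prod>m<length xs. xs ! m)" for xs :: "real list"
    by (induction xs) (simp_all add: prod.lessThan_Suc_shift del: prod.lessThan_Suc)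
  then show ?thesis
    by (simp add: cycle_product_def)
qed

text \<open>The only reciprocal matrix of size 1 has entry 1, which is consistent. The bound ensures
  that a Hamiltonian cycle has no loops, which the comparison digraph excludes.\<close>

lemma inconsistent_reciprocal_card_gt_1:
  fixes A :: "real ^ 'n ^ 'n"
  assumes "reciprocal_matrix A" "\<not> consistent_matrix A"
  shows "CARD('n) > 1"
proof (rule ccontr)
  assume "\<not> CARD('n) > 1"
  then have "CARD('n) = 1"
    using zero_less_card_finite[where 'a = 'n] by linarith
  then have eq: "i = j" for i j :: 'n
    by (metis UNIV_I card_1_singletonE singletonD)
  have "A $ i $ j = 1" for i j
  proof -
    have "A $ i $ i > 0" "A $ i $ i = 1 / A $ i $ i"
      using assms(1) unfolding reciprocal_matrix_def by blast+
    then have "(A $ i $ i)\<^sup>2 = 1"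
      by (simp add: field_simps power2_eq_square)
    with \<open>A $ i $ i > 0\<close> have "A $ i $ i = 1"
      by (simp add: power2_eq_1_iff)
    then show ?thesis
      by (metis eq)
  qed
  then have "A = (\<chi> i j. (1 :: real ^ 'n) $ i / (1 :: real ^ 'n) $ j)"
    by (simp add: vec_eq_iff)
  moreover have "positive_vec (1 :: real ^ 'n)"
    by (simp add: positive_vec_def)
  ultimately show False
    using assms(2) unfolding consistent_matrix_def by blast
qed

text \<open>The whole deviation of the cycle product from 1 is absorbed at one chosen edge. This
  construction yields both the vector without reversals and the one with a single reversal.\<close>

lemma exists_vec_corrected_at_edge:
  fixes A :: "real ^ 'n ^ 'n"
  assumes pos: "\<And>i j. 0 < A $ i $ j"
    and ham: "hamiltonian_cycle \<gamma>"
    and n: "CARD('n) > 1"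
    and P: "cycle_product A \<gamma> \<le> 1"
    and edge: "(p, q) \<in> set (cycle_edges \<gamma>)"
  obtains w where "w \<in> cycle_vectors A \<gamma>"
    and "w $ p = A $ p $ q / cycle_product A \<gamma> * w $ q"
    and "\<And>i j. (i, j) \<in> set (cycle_edges \<gamma>) \<Longrightarrow> (i, j) \<noteq> (p, q) \<Longrightarrow> w $ i = A $ i $ j * w $ j"
proof -
  let ?P = "cycle_product A \<gamma>" and ?a = "\<lambda>m. entries_along A \<gamma> ! m"
    and ?s = "\<lambda>m. \<gamma> ! (Suc m mod length \<gamma>)"
  have dist: "distinct \<gamma>" and len: "length \<gamma> > 1"
    using ham n distinct_card[of \<gamma>] by (auto simp: hamiltonian_cycle_def)
  obtain k where k: "k < length \<gamma>" "p = \<gamma> ! k" "q = ?s k"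
    using edge by (auto simp: set_cycle_edges)
  have a_pos: "?a m > 0" if "m < length \<gamma>" for m
    using that pos by (simp add: nth_entries_along)
  then have P_pos: "?P > 0"
    by (auto simp: cycle_product_eq_prod intro!: prod_pos)
  \<comment> \<open>The factor \<open>1 / ?P\<close> at position \<open>k\<close> brings the product
    of all ratios to 1.\<close>
  define r where "r m = ?a m * (if m = k then 1 / ?P else 1)" for m
  have "(\<Prod>m<length \<gamma>. r m) = ?P * (1 / ?P)"
    using k by (simp add: r_def prod.distrib cycle_product_eq_prod)
  also have "\<dots> = 1"
    using P_pos by simp
  finally have "(\<Prod>m<length \<gamma>. r m) = 1" .
  moreover have "r m > 0" if "m < length \<gamma>" for m
    using that a_pos P_pos by (simp add: r_def)
  ultimately obtain w where w: "positive_vec w"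
    "\<And>m. m < length \<gamma> \<Longrightarrow> w $ (\<gamma> ! m) = r m * w $ (?s m)"
    using exists_vec_with_ratios[OF ham] by metis
  have "A $ (\<gamma> ! m) $ (?s m) * w $ (?s m) \<le> w $ (\<gamma> ! m)" if m: "m < length \<gamma>" for m
  proof -
    have "w $ (?s m) > 0"
      using w(1) by (simp add: positive_vec_def)
    \<comment> \<open>Here the bound \<open>?P \<le> 1\<close> enters: the correction can only
      enlarge a ratio, which keeps every edge in the digraph.\<close>
    moreover have "?a m \<le> r m"
      using P P_pos a_pos[OF m] by (simp add: r_def field_simps mult_left_le)
    ultimately show ?thesis
      using m w(2) by (simp add: nth_entries_along)
  qed
  moreover have "\<gamma> ! m \<noteq> ?s m" if "m < length \<gamma>" for m
  proof -
    have "m \<noteq> Suc m mod length \<gamma>"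
      using that len by (cases "Suc m = length \<gamma>") auto
    moreover have "Suc m mod length \<gamma> < length \<gamma>"
      using that by (intro mod_less_divisor) auto
    ultimately show ?thesis
      using that dist by (simp add: nth_eq_iff_index_eq)
  qed
  ultimately have "w \<in> cycle_vectors A \<gamma>"
    using w(1) by (auto simp: cycle_vectors_def comparison_digraph_def set_cycle_edges)
  moreover have "w $ p = A $ p $ q / ?P * w $ q"
    using k w(2)[OF k(1)] by (simp add: r_def nth_entries_along)
  moreover have "w $ i = A $ i $ j * w $ j"
    if ij: "(i, j) \<in> set (cycle_edges \<gamma>)" "(i, j) \<noteq> (p, q)" for i j
  proof -
    obtain m where "m < length \<gamma>" "i = \<gamma> ! m" "j = ?s m"
      using ij(1) by (auto simp: set_cycle_edges)
    moreover have "m \<noteq> k"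
      using ij(2) k calculation by auto
    ultimately show ?thesis
      using w(2) by (simp add: r_def nth_entries_along)
  qed
  ultimately show ?thesis
    using that by blast
qed

text \<open>As \<open>w $ j\<close> is positive, comparing \<open>w $ i\<close> with
  \<open>w $ j\<close> amounts to comparing \<open>A $ i $ j\<close> with 1.\<close>

lemma not_order_reversal_if_ratio_eq:
  assumes "w $ j > 0" "w $ i = A $ i $ j * w $ j"
  shows "\<not> order_reversal A w i j"
  using assms by (auto simp: order_reversal_def)

text \<open>Factors that are all at least 1 have a product at least 1.\<close>

lemma exists_entry_less_1:
  assumes "cycle_product A \<gamma> < 1"
  obtains i j where "(i, j) \<in> set (cycle_edges \<gamma>)" "A $ i $ j < 1"
proof -
  have "\<exists>m<length \<gamma>. entries_along A \<gamma> ! m < 1"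
  proof (rule ccontr)
    assume "\<not> ?thesis"
    then have "1 \<le> (\<Prod>m<length \<gamma>. entries_along A \<gamma> ! m)"
      by (intro prod_ge_1) auto
    with assms show False
      by (simp add: cycle_product_eq_prod)
  qed
  then show ?thesis
    using that by (fastforce simp: nth_entries_along set_cycle_edges)
qed

theorem theorem13:
  fixes A :: "real ^ 'n ^ 'n" and \<gamma> :: "'n list"
  assumes "reciprocal_matrix A"
    and "\<not> consistent_matrix A"
    and "hamiltonian_cycle \<gamma>"
    and "cycle_product A \<gamma> \<le> 1"
  shows "((\<exists>w \<in> cycle_vectors A \<gamma>. \<forall>(i, j) \<in> set (cycle_edges \<gamma>). \<not> order_reversal A w i j) \<longleftrightarrow>
            (\<exists>a \<in> set (entries_along A \<gamma>). a > 1) \<or> cycle_product A \<gamma> = 1) \<and>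
         (\<not> ((\<exists>a \<in> set (entries_along A \<gamma>). a > 1) \<or> cycle_product A \<gamma> = 1) \<longrightarrow>
            (\<exists>w \<in> cycle_vectors A \<gamma>.
               card {(i, j). (i, j) \<in> set (cycle_edges \<gamma>) \<and> order_reversal A w i j} = 1))"
proof -
  let ?P = "cycle_product A \<gamma>" and ?E = "set (cycle_edges \<gamma>)"
    and ?big = "\<exists>a \<in> set (entries_along A \<gamma>). a > 1"
  have pos: "\<And>i j. 0 < A $ i $ j"
    using assms(1) unfolding reciprocal_matrix_def by blast
  have n: "CARD('n) > 1"
    using inconsistent_reciprocal_card_gt_1 assms(1,2) .
  then have "\<gamma> \<noteq> []"
    using assms(3) by (auto simp: hamiltonian_cycle_def)
  then obtain p q where edge: "(p, q) \<in> ?E"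
    using nth_mem[of 0 "cycle_edges \<gamma>"] by (cases "cycle_edges \<gamma> ! 0") simp
  have P_pos: "?P > 0"
    using pos by (auto simp: cycle_product_eq_prod nth_entries_along intro!: prod_pos)
  have w_pos: "w $ i > 0" if "w \<in> cycle_vectors A \<gamma>" for w i
    using that by (simp add: cycle_vectors_def positive_vec_def)
  note corrected = exists_vec_corrected_at_edge[OF pos assms(3) n assms(4)]

  have if_part: "\<exists>w \<in> cycle_vectors A \<gamma>. \<forall>(i, j) \<in> ?E. \<not> order_reversal A w i j"
    if big_or_1: "?big \<or> ?P = 1"
  proof -
    \<comment> \<open>If \<open>?P = 1\<close> the correction is trivial and any edge serves;
      otherwise it is placed on an edge whose entry exceeds 1, where enlarging the ratio does no
      harm.\<close>
    obtain p q where pq: "(p, q) \<in> ?E" "A $ p $ q > 1 \<or> ?P = 1"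
      using big_or_1 edge by (cases "?P = 1") (auto simp: set_entries_along)
    obtain w where w: "w \<in> cycle_vectors A \<gamma>"
      "w $ p = A $ p $ q / ?P * w $ q"
      "\<And>i j. (i, j) \<in> ?E \<Longrightarrow> (i, j) \<noteq> (p, q) \<Longrightarrow> w $ i = A $ i $ j * w $ j"
      using corrected[OF pq(1)] by metis
    have "\<not> order_reversal A w p q"
    proof (cases "?P = 1")
      case True
      with w show ?thesis
        by (intro not_order_reversal_if_ratio_eq) (auto intro: w_pos)
    next
      case False
      with pq(2) have gt: "A $ p $ q > 1"
        by simp
      then have "A $ p $ q / ?P > 1"
        using P_pos assms(4) by (simp add: field_simps)
      then have "w $ p > w $ q"
        using w(2) w_pos[OF w(1), of q] mult_strict_right_mono[of 1 "A $ p $ q / ?P" "w $ q"] by simp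
      with gt show ?thesis
        by (simp add: order_reversal_def)
    qed
    moreover have "\<not> order_reversal A w i j" if "(i, j) \<in> ?E" "(i, j) \<noteq> (p, q)" for i j
      using w that by (intro not_order_reversal_if_ratio_eq) (auto intro: w_pos)
    ultimately show ?thesis
      using w(1) by blast
  qed

  have only_if_part: False
    if small: "\<not> (?big \<or> ?P = 1)"
      and no_rev: "\<forall>(i, j) \<in> ?E. \<not> order_reversal A w i j" for w
  proof -
    obtain p q where pq: "(p, q) \<in> ?E" "A $ p $ q < 1"
      using exists_entry_less_1[of A \<gamma>] small assms(4) by (metis order_le_less)
    have "w $ i \<le> w $ j" if "(i, j) \<in> ?E" for i j
    proof -
      have "A $ i $ j \<le> 1"
        using that small by (force simp: set_entries_along)
      moreover have "\<not> order_reversal A w i j"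
        using that no_rev by blast
      ultimately show ?thesis
        unfolding order_reversal_def by linarith
    qed
    \<comment> \<open>Weak increase around the closed cycle leaves only equality, and equality is
      itself a reversal where the entry is less than 1.\<close>
    then have "w $ p = w $ q"
      using no_strict_increase_around_cycle[of \<gamma> "($) w"] pq(1) by blast
    with pq no_rev show False
      by (auto simp: order_reversal_def)
  qed

  have single: "\<exists>w \<in> cycle_vectors A \<gamma>. card {(i, j). (i, j) \<in> ?E \<and> order_reversal A w i j} = 1"
    if "\<not> (?big \<or> ?P = 1)"
  proof -
    \<comment> \<open>The corrected edge \<open>(p, q)\<close> is arbitrary here, as every choice
      confines reversals to one edge.\<close>
    obtain w where w: "w \<in> cycle_vectors A \<gamma>"
      "\<And>i j. (i, j) \<in> ?E \<Longrightarrow> (i, j) \<noteq> (p, q) \<Longrightarrow> w $ i = A $ i $ j * w $ j"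
      using corrected[OF edge] by metis
    have no_rev: "\<not> order_reversal A w i j" if "(i, j) \<in> ?E" "(i, j) \<noteq> (p, q)" for i j
      using w that by (intro not_order_reversal_if_ratio_eq) (auto intro: w_pos)
    \<comment> \<open>Without a reversal at \<open>(p, q)\<close> there would be none along the
      cycle, which \<open>only_if_part\<close> rules out.\<close>
    moreover have "order_reversal A w p q"
      using only_if_part[OF that, of w] no_rev by auto
    ultimately have "{(i, j). (i, j) \<in> ?E \<and> order_reversal A w i j} = {(p, q)}"
      using edge by blast
    with w(1) show ?thesis
      by (intro bexI[of _ w]) simp_all
  qed

  show ?thesis
    using if_part only_if_part single by blast
qed

end
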